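(* Let $H=\{6k+1:k\in\mathbb Z\}$ and consider the prime lattice $H\times H$. (1) The geometric locus of the solution set of the Prachar prime twins is the line $y=\tfrac12(x+1)$, i.e. the line through the point $(1,1)$ with slope $\tfrac12$. (2) The geometric locus of the solution set of the generalized Prachar prime twins is the bundle of lines with common intersection point $(1,1)$ and with the lattice points as second points. (3) The geometric locus of the solution set of the totally generalized Prachar prime twins is given by the comparable bundles of lines at every lattice point.
   Context: Primes may be negative; every prime other than $2$ and $3$ lies, up to sign, in $H$. The Prachar prime twins problem concerns pairs of primes $p,q$ with $p=\tfrac12(q-1)$; when transferred to the lattice $H\times H$ (a change of signs of the components), the relation becomes $p=\tfrac12(q+1)$, written $y=\tfrac12(x+1)$ in lattice coordinates. A lattice point is a point $(x,y)\in H\times H$; it is a solution if both components are primes. The generalized Prachar prime twins arise by rotating the line $y=\tfrac12(x+1)$ about $(1,1)$ so that it again passes through a second lattice point $(x_2,y_2)$, giving the line $(y-1)/(x-1)=(y_2-1)/(x_2-1)$. The totally generalized version arises by carrying out the same procedure at every lattice point instead of only at $(1,1)$. *)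

theory Defs
  imports "HOL-Analysis.Analysis" "HOL-Computational_Algebra.Primes"
begin

definition H :: "int set" where
  "H = {6 * k + 1 | k. True}"

definition prime_lattice :: "(int \<times> int) set" where
  "prime_lattice = H \<times> H"

text \<open>Primes may be negative, hence \<^const>\<open>prime_elem\<close> rather than \<^const>\<open>prime\<close>.\<close>

definition lattice_solutions :: "(int \<times> int) set" where
  "lattice_solutions = {(x, y) \<in> prime_lattice. prime_elem x \<and> prime_elem y}"

definition real_pt :: "int \<times> int \<Rightarrow> real \<times> real" where
  "real_pt P = (real_of_int (fst P), real_of_int (snd P))"

definition prachar_twins :: "(int \<times> int) set" where
  "prachar_twins = {(p, q). prime_elem p \<and> prime_elem q \<and>
     real_of_int p = 1 / 2 * (real_of_int q - 1)}"

text \<open>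
  The twins transferred to the lattice by changing the signs of the components. The abscissa
  \<open>x\<close> comes from \<open>q\<close>, the ordinate \<open>y\<close> from \<open>p\<close>.
  Twins with a component \<open>2\<close>, \<open>3\<close>, \<open>-2\<close> or \<open>-3\<close> have no image,
  for no choice of signs moves such a component into \<^const>\<open>H\<close>.
\<close>

definition prachar_solutions :: "(int \<times> int) set" where
  "prachar_solutions = {(x, y) \<in> prime_lattice.
     \<exists>(p, q) \<in> prachar_twins. \<bar>x\<bar> = \<bar>q\<bar> \<and> \<bar>y\<bar> = \<bar>p\<bar>}"

definition slope_line :: "real \<times> real \<Rightarrow> real \<Rightarrow> (real \<times> real) set" where
  "slope_line c m = {(x, y). y - snd c = m * (x - fst c)}"

definition rotate_about :: "real \<times> real \<Rightarrow> real \<Rightarrow> real \<times> real \<Rightarrow> real \<times> real" where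
  "rotate_about c \<theta> z =
     (fst c + cos \<theta> * (fst z - fst c) - sin \<theta> * (snd z - snd c),
      snd c + sin \<theta> * (fst z - fst c) + cos \<theta> * (snd z - snd c))"

text \<open>
  The lines obtained by rotating the line of slope \<open>1/2\<close> through the lattice point
  \<open>Q\<close> about \<open>Q\<close> into a position where it passes through a second lattice point.
\<close>

definition rotated_lines :: "int \<times> int \<Rightarrow> (real \<times> real) set set" where
  "rotated_lines Q = {L. \<exists>\<theta>. L = rotate_about (real_pt Q) \<theta> ` slope_line (real_pt Q) (1 / 2) \<and>
     (\<exists>P \<in> prime_lattice. P \<noteq> Q \<and> real_pt P \<in> L)}"

definition generalized_prachar_solutions :: "(int \<times> int) set" where
  "generalized_prachar_solutions =
     {P \<in> lattice_solutions. \<exists>L \<in> rotated_lines (1, 1). real_pt P \<in> L}"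

definition totally_generalized_prachar_solutions :: "(int \<times> int) set" where
  "totally_generalized_prachar_solutions =
     {P \<in> lattice_solutions. \<exists>Q \<in> prime_lattice. \<exists>L \<in> rotated_lines Q. real_pt P \<in> L}"

definition line_bundle :: "int \<times> int \<Rightarrow> (real \<times> real) set set" where
  "line_bundle Q = {affine hull {real_pt Q, real_pt P} | P. P \<in> prime_lattice \<and> P \<noteq> Q}"

text \<open>
  The discrete solution set \<open>S\<close> has a family of lines as its geometric locus when it
  consists of exactly those solutions in the lattice that lie on a line of the family.
\<close>

definition geometric_locus :: "(int \<times> int) set \<Rightarrow> (real \<times> real) set set \<Rightarrow> bool" where
  "geometric_locus S Ls \<longleftrightarrow> S = {P \<in> lattice_solutions. real_pt P \<in> \<Union>Ls}"

end

theory Submission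
  imports Defs
begin

text \<open>
  Modulo 6 the Prachar relation \<open>q = 2 p + 1\<close> between elements of \<open>H\<close> up to sign is only
  possible when both signs are changed, which turns it into \<open>x = 2 y - 1\<close>. The two solutions
  \<open>(-11, -5)\<close> and \<open>(-23, -11)\<close> already span that line. For the bundles, every direction
  is a rotation of a multiple of \<open>(1, m)\<close>: as complex numbers, \<open>(1 + i m) e\<^bsup>i\<theta>\<^esup>\<close>
  is a multiple of \<open>d\<close> when \<open>\<theta>\<close> is the argument of \<open>d (1 - i m)\<close>.
\<close>

section \<open>Lines through a base point with a given direction\<close>

text \<open>The vanishing cross product of \<open>d\<close> and \<open>w - c\<close> treats vertical
  lines like all others and is insensitive to scaling \<open>d\<close>. For \<open>d = 0\<close> it
  describes the whole plane, hence the nonzero conditions below.\<close>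

definition direction_line :: "real \<times> real \<Rightarrow> real \<times> real \<Rightarrow> (real \<times> real) set" where
  "direction_line c d = {w. snd d * (fst w - fst c) = fst d * (snd w - snd c)}"

lemma affine_hull_eq_direction_line:
  assumes "z \<noteq> c"
  shows "affine hull {c, z} = direction_line c (z - c)"
proof (intro equalityI subsetI)
  fix w assume "w \<in> affine hull {c, z}"
  then obtain u v where "u + v = 1" and w: "w = u *\<^sub>R c + v *\<^sub>R z"
    by (auto simp: affine_hull_2)
  then have u: "u = 1 - v" by simp
  show "w \<in> direction_line c (z - c)"
    unfolding direction_line_def w u by (simp add: algebra_simps)
next
  fix w assume "w \<in> direction_line c (z - c)"
  then have eq: "(snd z - snd c) * (fst w - fst c) = (fst z - fst c) * (snd w - snd c)"
    by (simp add: direction_line_def)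
  have "\<exists>v. w = (1 - v) *\<^sub>R c + v *\<^sub>R z"
  \<comment> \<open>The parameter \<open>v\<close> is read off from a coordinate in which
    \<open>z\<close> and \<open>c\<close> differ.\<close>
  proof (cases "fst z = fst c")
    case True
    with assms have ne: "snd z - snd c \<noteq> 0" by (auto simp: prod_eq_iff)
    define v where "v = (snd w - snd c) / (snd z - snd c)"
    have "v * (snd z - snd c) = snd w - snd c" using ne by (simp add: v_def)
    moreover have "fst w = fst c" using eq True ne by simp
    ultimately show ?thesis
      using True by (intro exI[of _ v]) (simp add: prod_eq_iff algebra_simps)
  next
    case False
    then have ne: "fst z - fst c \<noteq> 0" by simp
    define v where "v = (fst w - fst c) / (fst z - fst c)"
    have "v * (fst z - fst c) = fst w - fst c" using ne by (simp add: v_def)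
    moreover have "v * (snd z - snd c) = snd w - snd c"
      using ne eq by (simp add: v_def field_simps)
    ultimately show ?thesis
      by (intro exI[of _ v]) (simp add: prod_eq_iff algebra_simps)
  qed
  then obtain v where "w = (1 - v) *\<^sub>R c + v *\<^sub>R z" ..
  then show "w \<in> affine hull {c, z}"
    unfolding affine_hull_2 by (intro CollectI exI[of _ "1 - v"] exI[of _ v]) simp
qed

lemma direction_line_scaleR:
  assumes "r \<noteq> 0"
  shows "direction_line c (r *\<^sub>R d) = direction_line c d"
  using assms by (simp add: direction_line_def)

text \<open>The vanishing cross product makes \<open>z - c\<close> a multiple of \<open>d\<close>,
  nonzero since \<open>z \<noteq> c\<close>, and scaling a direction does not change its
  line.\<close>

lemma direction_line_eq_through:
  assumes "z \<in> direction_line c d" "z \<noteq> c" "d \<noteq> 0"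
  shows "direction_line c d = direction_line c (z - c)"
proof -
  have eq: "snd d * (fst z - fst c) = fst d * (snd z - snd c)"
    using assms(1) by (simp add: direction_line_def)
  have "\<exists>r. z - c = r *\<^sub>R d"
  proof (cases "fst d = 0")
    case True
    with assms(3) have "snd d \<noteq> 0" by (auto simp: prod_eq_iff)
    with True eq show ?thesis
      by (intro exI[of _ "(snd z - snd c) / snd d"]) (simp add: prod_eq_iff)
  next
    case False
    with eq show ?thesis
      by (intro exI[of _ "(fst z - fst c) / fst d"]) (simp add: prod_eq_iff field_simps)
  qed
  then obtain r where r: "z - c = r *\<^sub>R d" ..
  moreover have "r \<noteq> 0" using r assms(2) by auto
  ultimately show ?thesis by (simp add: direction_line_scaleR)
qed

section \<open>Rotations of a line of given slope\<close>

lemma rotate_about_inverse: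
  "rotate_about c \<theta> (rotate_about c (- \<theta>) w) = w"
proof -
  have *: "cos \<theta> * (cos \<theta> * t) + sin \<theta> * (sin \<theta> * t) = t" for t
    using sin_cos_squared_add[of \<theta>]
    by (metis (no_types) add.commute distrib_right mult.assoc mult_1 power2_eq_square)
  show ?thesis
    using *[of "fst w - fst c"] *[of "snd w - snd c"]
    by (simp add: rotate_about_def prod_eq_iff algebra_simps)
qed

text \<open>The direction on the right is \<open>(1, m)\<close> turned by the angle
  \<theta>.\<close>

lemma rotate_about_slope_line:
  "rotate_about c \<theta> ` slope_line c m =
     direction_line c (cos \<theta> - m * sin \<theta>, sin \<theta> + m * cos \<theta>)"
proof (intro equalityI subsetI)
  fix w assume "w \<in> rotate_about c \<theta> ` slope_line c m"
  then obtain x y where "y - snd c = m * (x - fst c)" and "w = rotate_about c \<theta> (x, y)"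
    by (auto simp: slope_line_def)
  then show "w \<in> direction_line c (cos \<theta> - m * sin \<theta>, sin \<theta> + m * cos \<theta>)"
    by (simp add: direction_line_def rotate_about_def) (simp add: algebra_simps)
next
  fix w assume "w \<in> direction_line c (cos \<theta> - m * sin \<theta>, sin \<theta> + m * cos \<theta>)"
  then have "rotate_about c (- \<theta>) w \<in> slope_line c m"
    by (simp add: direction_line_def rotate_about_def slope_line_def algebra_simps)
  then show "w \<in> rotate_about c \<theta> ` slope_line c m"
    using rotate_about_inverse[of c \<theta> w] by (metis imageI)
qed

lemma rotated_direction_nonzero:
  "(cos \<theta> - m * sin \<theta>, sin \<theta> + m * cos \<theta>) \<noteq> (0 :: real \<times> real)"
proof
  assume "(cos \<theta> - m * sin \<theta>, sin \<theta> + m * cos \<theta>) = (0 :: real \<times> real)"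
  then have c: "cos \<theta> = m * sin \<theta>" and s: "sin \<theta> = - (m * cos \<theta>)"
    by (auto simp: zero_prod_def)
  \<comment> \<open>One factor of each square is replaced by means of \<open>s\<close> and
    \<open>c\<close>; the two products then cancel.\<close>
  have "sin \<theta> * sin \<theta> + cos \<theta> * cos \<theta> = sin \<theta> * (- (m * cos \<theta>)) + cos \<theta> * (m * sin \<theta>)"
    using c s by metis
  then have "sin \<theta> * sin \<theta> + cos \<theta> * cos \<theta> = 0"
    by (simp add: algebra_simps)
  then show False
    using sin_cos_squared_add[of \<theta>] by (simp add: power2_eq_square)
qed

lemma exists_rotation_to_direction:
  assumes "d \<noteq> 0"
  shows "\<exists>\<theta>. rotate_about c \<theta> ` slope_line c m = direction_line c d"
proof -
  \<comment> \<open>\<open>a\<close> and \<open>b\<close> are the real and imaginary parts of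
    \<open>d (1 - i m)\<close>; \<open>r\<close> is its modulus.\<close>
  define a where "a = fst d + m * snd d"
  define b where "b = snd d - m * fst d"
  define r where "r = sqrt (a\<^sup>2 + b\<^sup>2)"
  \<comment> \<open>The squared modulus is multiplicative, so \<open>r\<close> is nonzero.\<close>
  have "a\<^sup>2 + b\<^sup>2 = (1 + m\<^sup>2) * ((fst d)\<^sup>2 + (snd d)\<^sup>2)"
    by (simp add: a_def b_def power2_eq_square algebra_simps)
  moreover have "(fst d)\<^sup>2 + (snd d)\<^sup>2 > 0"
    using assms by (auto simp: prod_eq_iff sum_power2_gt_zero_iff)
  moreover have "1 + m\<^sup>2 > 0"
    by (simp add: add_pos_nonneg)
  ultimately have pos: "a\<^sup>2 + b\<^sup>2 > 0" by simp
  then have r: "r > 0" "r\<^sup>2 = a\<^sup>2 + b\<^sup>2" by (simp_all add: r_def)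
  then have "(a / r)\<^sup>2 + (b / r)\<^sup>2 = 1"
    using pos by (metis add_divide_distrib div_self less_irrefl power_divide)
  then obtain \<theta> where t: "a / r = cos \<theta>" "b / r = sin \<theta>"
    using sincos_total_2pi by metis
  \<comment> \<open>Multiply \<open>d (1 - i m) / r\<close>, the unit number of angle \<theta>, by
    \<open>1 + i m\<close>.\<close>
  have "(cos \<theta> - m * sin \<theta>, sin \<theta> + m * cos \<theta>) = ((1 + m\<^sup>2) / r) *\<^sub>R d"
    unfolding t[symmetric] prod_eq_iff using r(1)
    by (simp add: a_def b_def field_simps power2_eq_square)
  moreover have "(1 + m\<^sup>2) / r \<noteq> 0"
    using r(1) \<open>1 + m\<^sup>2 > 0\<close> by simp
  ultimately show ?thesis
    using direction_line_scaleR rotate_about_slope_line by metis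
qed

section \<open>Bundles of lines at a lattice point\<close>

lemma real_pt_eq_iff [simp]: "real_pt P = real_pt Q \<longleftrightarrow> P = Q"
  by (auto simp: real_pt_def prod_eq_iff)

lemma line_bundle_eq_direction_lines:
  "line_bundle Q = {direction_line (real_pt Q) (real_pt P - real_pt Q) | P. P \<in> prime_lattice \<and> P \<noteq> Q}"
proof -
  have "affine hull {real_pt Q, real_pt P} = direction_line (real_pt Q) (real_pt P - real_pt Q)"
    if "P \<noteq> Q" for P
    using that by (simp add: affine_hull_eq_direction_line)
  then show ?thesis unfolding line_bundle_def by blast
qed

text \<open>Two distinct points determine their line, which gives one inclusion; for the other, some
  rotation reaches the direction from \<open>Q\<close> to any second lattice point.\<close>

lemma rotated_lines_eq_line_bundle: "rotated_lines Q = line_bundle Q"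
proof (intro equalityI subsetI)
  fix L assume "L \<in> rotated_lines Q"
  then obtain \<theta> P where L: "L = rotate_about (real_pt Q) \<theta> ` slope_line (real_pt Q) (1 / 2)"
    and P: "P \<in> prime_lattice" "P \<noteq> Q" "real_pt P \<in> L"
    unfolding rotated_lines_def by blast
  have "L = direction_line (real_pt Q) (real_pt P - real_pt Q)"
    using P direction_line_eq_through[OF _ _ rotated_direction_nonzero] real_pt_eq_iff
    unfolding L rotate_about_slope_line by metis
  with P show "L \<in> line_bundle Q"
    unfolding line_bundle_eq_direction_lines by blast
next
  fix L assume "L \<in> line_bundle Q"
  then obtain P where P: "P \<in> prime_lattice" "P \<noteq> Q"
    and L: "L = direction_line (real_pt Q) (real_pt P - real_pt Q)"
    unfolding line_bundle_eq_direction_lines by blast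
  have "real_pt P - real_pt Q \<noteq> 0" using P by simp
  then obtain \<theta> where "L = rotate_about (real_pt Q) \<theta> ` slope_line (real_pt Q) (1 / 2)"
    using exists_rotation_to_direction L by metis
  moreover have "real_pt P \<in> L" by (simp add: L direction_line_def)
  ultimately show "L \<in> rotated_lines Q"
    using P unfolding rotated_lines_def by blast
qed

lemma H_iff: "x \<in> H \<longleftrightarrow> x mod 6 = 1"
proof
  assume "x mod 6 = 1"
  then have "x = 6 * (x div 6) + 1" by presburger
  then show "x \<in> H" unfolding H_def by blast
next
  assume "x \<in> H"
  then obtain k where "x = 6 * k + 1" unfolding H_def by blast
  then show "x mod 6 = 1" by presburger
qed

lemma Inter_line_bundle:
  assumes "Q \<in> prime_lattice"
  shows "\<Inter>(line_bundle Q) = {real_pt Q}"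
proof (intro equalityI subsetI)
  obtain x y where Q: "Q = (x, y)" by fastforce
  with assms have h: "x mod 6 = 1" "y mod 6 = 1" by (auto simp: prime_lattice_def H_iff)
  \<comment> \<open>Neighbours at distance 6, the spacing of \<open>H\<close>: they give the
    horizontal and the vertical line through \<open>Q\<close>, which meet only there.\<close>
  have 1: "(x + 6, y) \<in> prime_lattice" and 2: "(x, y + 6) \<in> prime_lattice"
    using h by (auto simp: prime_lattice_def H_iff)
  fix w assume w: "w \<in> \<Inter>(line_bundle Q)"
  have "w \<in> direction_line (real_pt Q) (real_pt P - real_pt Q)"
    if "P \<in> prime_lattice" "P \<noteq> Q" for P
    using w that unfolding line_bundle_eq_direction_lines by blast
  from this[OF 1] this[OF 2] show "w \<in> {real_pt Q}"
    by (auto simp: Q direction_line_def real_pt_def prod_eq_iff)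
next
  fix w assume "w \<in> {real_pt Q}"
  then show "w \<in> \<Inter>(line_bundle Q)"
    by (auto simp: line_bundle_eq_direction_lines direction_line_def)
qed

section \<open>Prachar twins in the lattice\<close>

lemma prachar_solutions_eq:
  "prachar_solutions = {(x, y) \<in> lattice_solutions. x = 2 * y - 1}"
proof (intro equalityI subsetI)
  fix P assume "P \<in> prachar_solutions"
  then obtain x y p q where P: "P = (x, y)" and lat: "(x, y) \<in> prime_lattice"
    and pr: "prime_elem p" "prime_elem q" and rel: "real_of_int p = 1 / 2 * (real_of_int q - 1)"
    and s: "\<bar>x\<bar> = \<bar>q\<bar>" "\<bar>y\<bar> = \<bar>p\<bar>"
    unfolding prachar_solutions_def prachar_twins_def by auto
  have "real_of_int q = real_of_int (2 * p + 1)" using rel by simp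
  then have q: "q = 2 * p + 1" by linarith
  obtain a b where h: "x = 6 * a + 1" "y = 6 * b + 1"
    using lat by (auto simp: prime_lattice_def H_def)
  have sg: "x = q \<or> x = - q" "y = p \<or> y = - p" using s by auto
  \<comment> \<open>Since \<open>y\<close> is 1 modulo 6, \<open>2 * y + 1\<close> and its negative
    are both 3 modulo 6, so neither lies in \<open>H\<close>.\<close>
  have "y \<noteq> p"
  proof
    assume "y = p"
    with sg(1) q have "x = 2 * y + 1 \<or> x = - (2 * y + 1)" by simp
    then show False unfolding h by presburger
  qed
  then have y: "y = - p" using sg(2) by blast
  \<comment> \<open>Here \<open>x\<close> would be \<open>1 - 2 * y\<close>, which is 5 modulo
    6.\<close>
  moreover have "x \<noteq> q"
  proof
    assume "x = q"
    with y q have "x = 1 - 2 * y" by simp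
    then show False unfolding h by presburger
  qed
  ultimately have "x = 2 * y - 1" using sg(1) q by simp
  moreover have "prime_elem x" "prime_elem y"
    using pr s by simp_all
  ultimately show "P \<in> {(x, y) \<in> lattice_solutions. x = 2 * y - 1}"
    using P lat by (simp add: lattice_solutions_def)
next
  fix P assume "P \<in> {(x, y) \<in> lattice_solutions. x = 2 * y - 1}"
  then obtain x y where P: "P = (x, y)" "(x, y) \<in> prime_lattice" "prime_elem x" "prime_elem y"
    "x = 2 * y - 1"
    by (auto simp: lattice_solutions_def)
  \<comment> \<open>Changing both signs back turns \<open>x = 2 * y - 1\<close> into the twin
    relation.\<close>
  have "(- y, - x) \<in> prachar_twins"
    using P(3-5) by (simp add: prachar_twins_def abs_minus_commute)
  then have "\<exists>(p, q) \<in> prachar_twins. \<bar>x\<bar> = \<bar>q\<bar> \<and> \<bar>y\<bar> = \<bar>p\<bar>"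
    by (rule bexI[rotated]) simp
  with P show "P \<in> prachar_solutions" by (simp add: prachar_solutions_def)
qed

section \<open>The line of the Prachar twins\<close>

lemma real_pt_mem_prachar_line:
  "real_pt P \<in> {(x, y). y = 1 / 2 * (x + 1)} \<longleftrightarrow> fst P = 2 * snd P - 1"
proof -
  have "real_pt P \<in> {(x, y). y = 1 / 2 * (x + 1)} \<longleftrightarrow>
      real_of_int (fst P) = real_of_int (2 * snd P - 1)"
    by (auto simp: real_pt_def)
  then show ?thesis by linarith
qed

lemma geometric_locus_prachar_solutions:
  "geometric_locus prachar_solutions {{(x, y). y = 1 / 2 * (x + 1)}}"
  unfolding geometric_locus_def prachar_solutions_eq Union_insert Union_empty Un_empty_right
    real_pt_mem_prachar_line
  by auto

lemma prachar_line_eq_slope_line: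
  "{(x, y). y = 1 / 2 * (x + 1)} = slope_line (1, 1) (1 / 2)"
  by (auto simp: slope_line_def)

text \<open>Images of the twins (5, 11) and (11, 23) under the change of both signs.\<close>

lemma two_prachar_solutions:
  "(-11, -5) \<in> prachar_solutions" "(-23, -11) \<in> prachar_solutions"
proof -
  have "prime_elem (- 5 :: int)" "prime_elem (- 11 :: int)" "prime_elem (- 23 :: int)"
    by simp_all
  then show "(-11, -5) \<in> prachar_solutions" "(-23, -11) \<in> prachar_solutions"
    by (simp_all add: prachar_solutions_eq lattice_solutions_def prime_lattice_def H_iff)
qed

text \<open>\<open>geometric_locus\<close> only compares the solutions lying on the line; the hull
  shows that no smaller affine set contains them.\<close>

lemma affine_hull_prachar_solutions:
  "affine hull (real_pt ` prachar_solutions) = {(x, y). y = 1 / 2 * (x + 1)}" (is "_ = ?L")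
proof
  \<comment> \<open>The difference of the points is \<open>(-12, -6)\<close>, of slope 1/2. The
    equation shows that \<open>?L\<close> is affine, for the upper bound, and gives the lower bound
    by monotonicity.\<close>
  have L: "affine hull {real_pt (-11, -5), real_pt (-23, -11)} = ?L"
    by (subst affine_hull_eq_direction_line) (auto simp: direction_line_def real_pt_def)
  then have "affine ?L" by (metis affine_affine_hull)
  moreover have "real_pt ` prachar_solutions \<subseteq> ?L"
    unfolding prachar_solutions_eq image_subset_iff real_pt_mem_prachar_line
    by auto
  ultimately show "affine hull (real_pt ` prachar_solutions) \<subseteq> ?L"
    by (rule hull_minimal[rotated])
  show "?L \<subseteq> affine hull (real_pt ` prachar_solutions)"
    unfolding L[symmetric] using two_prachar_solutions by (intro hull_mono) auto
qed

theorem mainTheorem7: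
  "(geometric_locus prachar_solutions {{(x, y). y = 1 / 2 * (x + 1)}} \<and>
    affine hull (real_pt ` prachar_solutions) = {(x, y). y = 1 / 2 * (x + 1)} \<and>
    {(x, y). y = 1 / 2 * (x + 1)} = slope_line (1, 1) (1 / 2)) \<and>
   (geometric_locus generalized_prachar_solutions (line_bundle (1, 1)) \<and>
    rotated_lines (1, 1) = line_bundle (1, 1) \<and>
    \<Inter>(line_bundle (1, 1)) = {(1, 1)}) \<and>
   (geometric_locus totally_generalized_prachar_solutions (\<Union>Q \<in> prime_lattice. line_bundle Q) \<and>
    (\<forall>Q \<in> prime_lattice. rotated_lines Q = line_bundle Q \<and>
       \<Inter>(line_bundle Q) = {real_pt Q}))"
proof -
  \<comment> \<open>Both bundle loci follow by unfolding, once rotated lines are replaced by the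
    bundles equal to them.\<close>
  have "geometric_locus generalized_prachar_solutions (line_bundle (1, 1))"
    by (auto simp: geometric_locus_def generalized_prachar_solutions_def rotated_lines_eq_line_bundle)
  moreover have "geometric_locus totally_generalized_prachar_solutions
      (\<Union>Q \<in> prime_lattice. line_bundle Q)"
    by (auto simp: geometric_locus_def totally_generalized_prachar_solutions_def
        rotated_lines_eq_line_bundle)
  moreover have "\<Inter>(line_bundle (1, 1)) = {(1, 1)}"
    using Inter_line_bundle[of "(1, 1)"] by (simp add: prime_lattice_def H_iff real_pt_def)
  ultimately show ?thesis
    using geometric_locus_prachar_solutions affine_hull_prachar_solutions
      prachar_line_eq_slope_line rotated_lines_eq_line_bundle Inter_line_bundle by blast
qed

end
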